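(* Let $(E,\mathcal E,\mu)$ be a probability space, let $w\ge 0$ be a measurable function on $E$, let $\alpha>1$ and $\beta=\frac{\alpha}{\alpha-1}$. Let $\nu$ be an arbitrary probability measure on $(E,\mathcal E)$ and write $T_\alpha=T_\alpha(\nu\|\mu)$. If $1<\alpha\le 2$, then $$\|w(\nu-\mu)\|_{\rm TV}\le \frac{16}{3}\,\|w\|_\beta\,\max\big\{\sqrt{T_\alpha},\,T_\alpha^{1/\alpha}\big\}.$$ If $\alpha\ge 2$, then $$\|w(\nu-\mu)\|_{\rm TV}\le 3^\alpha\,\|w\|_\beta\,T_\alpha^{1/\alpha}.$$
   Context: The Rényi divergence power (Tsallis distance) of order $\alpha>1$ is $T_\alpha(\nu\|\mu)=\frac{1}{\alpha-1}\left[\int f^\alpha\,d\mu-1\right]$ if $\nu$ is absolutely continuous with respect to $\mu$ with density $f=d\nu/d\mu$ (value $+\infty$ allowed), and $T_\alpha(\nu\|\mu)=\infty$ otherwise. The weighted total variation distance is $\|w(\nu-\mu)\|_{\rm TV}=\int w\,d|\nu-\mu|$, which equals $\int w\,|f-1|\,d\mu$ when $\nu$ has density $f$ with respect to $\mu$. $\|u\|_p=\left(\int|u|^p\,d\mu\right)^{1/p}$ (possibly $+\infty$). If one of the factors on a right-hand side is $+\infty$, that right-hand side is read as $+\infty$ and the inequality is trivial. *)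

theory Defs
  imports "HOL-Probability.Probability"
begin

text \<open>
  The total variation measure \<open>|\<nu> - \<mu>|\<close> of the signed measure \<open>\<nu> - \<mu>\<close>, for finite measures on
  the same sigma-algebra: its value on \<open>A\<close> is the supremum of \<open>\<Sum>B\<in>P. |\<nu> B - \<mu> B|\<close> over all finite
  measurable partitions \<open>P\<close> of \<open>A\<close>. Absolute continuity is not required.
\<close>

definition tv_measure :: "'a measure \<Rightarrow> 'a measure \<Rightarrow> 'a measure" where
  "tv_measure \<nu> \<mu> = measure_of (space \<mu>) (sets \<mu>)
     (\<lambda>A. SUP P \<in> {P. finite P \<and> P \<subseteq> sets \<mu> \<and> partition_on A P}.
            (\<Sum>B\<in>P. ennreal \<bar>measure \<nu> B - measure \<mu> B\<bar>))"

definition weighted_tv :: "('a \<Rightarrow> real) \<Rightarrow> 'a measure \<Rightarrow> 'a measure \<Rightarrow> ereal" where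
  "weighted_tv w \<nu> \<mu> = enn2ereal (\<integral>\<^sup>+ x. ennreal (w x) \<partial>tv_measure \<nu> \<mu>)"

text \<open>Powers, square roots and products of extended reals, meant for arguments in \<open>[0, \<infinity>]\<close>.\<close>

definition ext_powr :: "ereal \<Rightarrow> real \<Rightarrow> ereal" where
  "ext_powr x p = (if x = \<infinity> then \<infinity> else ereal (real_of_ereal x powr p))"

definition ext_sqrt :: "ereal \<Rightarrow> ereal" where
  "ext_sqrt x = (if x = \<infinity> then \<infinity> else ereal (sqrt (real_of_ereal x)))"

text \<open>
  A product with an infinite factor is read as \<open>\<infinity>\<close>, even if the other factor is \<open>0\<close>; the library
  multiplication on \<^typ>\<open>ereal\<close> has \<open>0 * \<infinity> = 0\<close> instead.
\<close>

definition ext_mult :: "ereal \<Rightarrow> ereal \<Rightarrow> ereal" where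
  "ext_mult x y = (if x = \<infinity> \<or> y = \<infinity> then \<infinity> else x * y)"

definition lp_norm :: "'a measure \<Rightarrow> real \<Rightarrow> ('a \<Rightarrow> real) \<Rightarrow> ereal" where
  "lp_norm \<mu> p u = ext_powr (enn2ereal (\<integral>\<^sup>+ x. ennreal (\<bar>u x\<bar> powr p) \<partial>\<mu>)) (1 / p)"

text \<open>
  The Renyi divergence power (Tsallis distance) of order \<open>\<alpha>\<close>. For probability measures the density
  \<^term>\<open>RN_deriv \<mu> \<nu>\<close>, of type \<^typ>\<open>'a \<Rightarrow> ennreal\<close>, is finite \<open>\<mu>\<close>-almost everywhere, so
  \<^const>\<open>enn2real\<close> alters it only on a null set. The subtraction is that of \<^typ>\<open>ereal\<close> (not
  truncated at \<open>0\<close>).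
\<close>

definition tsallis :: "real \<Rightarrow> 'a measure \<Rightarrow> 'a measure \<Rightarrow> ereal" where
  "tsallis \<alpha> \<nu> \<mu> =
     (if absolutely_continuous \<mu> \<nu>
      then ereal (1 / (\<alpha> - 1)) *
             (enn2ereal (\<integral>\<^sup>+ x. ennreal (enn2real (RN_deriv \<mu> \<nu> x) powr \<alpha>) \<partial>\<mu>) - 1)
      else \<infinity>)"

end

theory Submission
  imports Defs
begin

text \<open>
  Only the case where \<open>T = T\<^sub>\<alpha>\<close> and \<open>\<parallel>w\<parallel>\<^sub>\<beta>\<close> are both finite has content. Then \<open>\<nu>\<close> has a density \<open>f\<close>
  (lemma \<open>tsallis_finite_density\<close>), the weighted total variation is at most \<open>\<integral> w |f - 1| d\<mu>\<close>, and
  Hoelder's inequality bounds this by \<open>\<parallel>w\<parallel>\<^sub>\<beta> \<parallel>f - 1\<parallel>\<^sub>\<alpha>\<close>. So everything rests on bounding the central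
  moment \<open>\<integral> |f - 1|\<^sup>\<alpha> d\<mu>\<close> in terms of \<open>T\<close> (lemma \<open>central_moment_le\<close>).

  Since \<open>f\<close> has mean \<open>1\<close>, a linear term may be subtracted for free:
  \<open>(\<alpha> - 1) T = \<integral> \<phi>(f) d\<mu>\<close> with \<open>\<phi>(u) = u\<^sup>\<alpha> - 1 - \<alpha> (u - 1) \<ge> 0\<close>, the gap between the power function
  and its tangent at \<open>1\<close>. Unlike \<open>u\<^sup>\<alpha> - 1\<close>, this gap dominates distances from \<open>1\<close> pointwise.

  If \<open>\<alpha> \<ge> 2\<close>, then \<open>|u - 1|\<^sup>\<alpha> \<le> \<phi>(u)\<close>, so the moment is at most \<open>(\<alpha> - 1) T\<close>, and
  \<open>\<alpha> - 1 \<le> 3\<^sup>\<alpha>\<close> leaves ample room.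

  If \<open>1 < \<alpha> \<le> 2\<close>, the gap is quadratic near \<open>1\<close> and of order \<open>\<alpha>\<close> far away:
  \<open>(\<alpha> - 1) / 3 * (u - 1)\<^sup>2 \<le> \<phi>(u)\<close> for \<open>u \<le> 2\<close> and
  \<open>(\<alpha> - 1) / 3 * (u - 1)\<^sup>\<alpha> \<le> \<phi>(u)\<close> for \<open>u \<ge> 2\<close>. On the first region the exponent \<open>\<alpha>\<close> is compared
  with \<open>2\<close> through Jensen's inequality for the concave power \<open>\<alpha> / 2\<close>. The two regions contribute
  \<open>(3 T)\<close> to the power \<open>\<alpha> / 2\<close> and \<open>3 T\<close>, which is where the maximum of \<open>\<surd>T\<close> and \<open>T\<close> to the power
  \<open>1 / \<alpha>\<close> comes from; the resulting constant is at most \<open>2 + 3 < 16 / 3\<close>.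
\<close>

section \<open>Pointwise estimates for the gap of the power function above its tangent\<close>

definition power_gap :: "real \<Rightarrow> real \<Rightarrow> real" where
  "power_gap \<alpha> u = u powr \<alpha> - 1 - \<alpha> * (u - 1)"

lemma power_gap_has_derivative:
  assumes "v > 0"
  shows "(power_gap \<alpha> has_real_derivative \<alpha> * (v powr (\<alpha> - 1) - 1)) (at v)"
  unfolding power_gap_def [abs_def]
  using assms by (auto intro!: derivative_eq_intros simp: algebra_simps)

lemma power_gap_continuous_on:
  assumes "\<alpha> > 0" "a \<ge> 0"
  shows "continuous_on {a..b} (power_gap \<alpha>)"
  unfolding power_gap_def [abs_def]
  using assms by (intro continuous_intros continuous_on_powr') auto

text \<open>
  The gap and its derivative vanish at \<open>1\<close>. Bounds for it therefore follow from bounds for its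
  derivative, moving away from \<open>1\<close> to either side. Derivatives are compared only on open
  intervals, so that no power is ever differentiated at base \<open>0\<close>.
\<close>

lemma power_gap_ge_right:
  assumes "\<alpha> > 0" "1 \<le> c" "c \<le> u" "H c \<le> power_gap \<alpha> c"
    and cont: "continuous_on {c..u} H"
    and deriv: "\<And>v. c < v \<Longrightarrow> v < u \<Longrightarrow>
      \<exists>D. (H has_real_derivative D) (at v) \<and> D \<le> \<alpha> * (v powr (\<alpha> - 1) - 1)"
  shows "H u \<le> power_gap \<alpha> u"
proof -
  have "power_gap \<alpha> c - H c \<le> power_gap \<alpha> u - H u"
  proof (rule DERIV_nonneg_imp_increasing_open [OF \<open>c \<le> u\<close>])
    fix v assume v: "c < v" "v < u"
    then obtain D where "(H has_real_derivative D) (at v)" "D \<le> \<alpha> * (v powr (\<alpha> - 1) - 1)"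
      using deriv by blast
    then show "\<exists>y. ((\<lambda>v. power_gap \<alpha> v - H v) has_real_derivative y) (at v) \<and> 0 \<le> y"
      using v assms
      by (intro exI [of _ "\<alpha> * (v powr (\<alpha> - 1) - 1) - D"] conjI DERIV_diff power_gap_has_derivative) auto
  qed (use assms in \<open>intro continuous_intros power_gap_continuous_on cont; simp\<close>)
  with assms show ?thesis by linarith
qed

lemma power_gap_ge_left:
  assumes "\<alpha> > 0" "0 \<le> u" "u \<le> 1" "H 1 \<le> 0"
    and cont: "continuous_on {u..1} H"
    and deriv: "\<And>v. u < v \<Longrightarrow> v < 1 \<Longrightarrow>
      \<exists>D. (H has_real_derivative D) (at v) \<and> \<alpha> * (v powr (\<alpha> - 1) - 1) \<le> D"
  shows "H u \<le> power_gap \<alpha> u"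
proof -
  have "power_gap \<alpha> 1 - H 1 \<le> power_gap \<alpha> u - H u"
  proof (rule DERIV_nonpos_imp_decreasing_open [OF \<open>u \<le> 1\<close>])
    fix v assume v: "u < v" "v < 1"
    then obtain D where "(H has_real_derivative D) (at v)" "\<alpha> * (v powr (\<alpha> - 1) - 1) \<le> D"
      using deriv by blast
    then show "\<exists>y. ((\<lambda>v. power_gap \<alpha> v - H v) has_real_derivative y) (at v) \<and> y \<le> 0"
      using v assms
      by (intro exI [of _ "\<alpha> * (v powr (\<alpha> - 1) - 1) - D"] conjI DERIV_diff power_gap_has_derivative) auto
  qed (use assms in \<open>intro continuous_intros power_gap_continuous_on cont; simp\<close>)
  with assms show ?thesis by (simp add: power_gap_def)
qed

text \<open>
  Split off one factor, writing the \<open>p\<close>-th power of \<open>z\<close> as \<open>z\<close> times its power \<open>p - 1\<close>: enlarging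
  the base of the latter to \<open>x + y\<close> in both summands gives the claim by distributivity.
\<close>

lemma powr_superadditive:
  fixes x y p :: real
  assumes "x \<ge> 0" "y \<ge> 0" "p \<ge> 1"
  shows "x powr p + y powr p \<le> (x + y) powr p"
proof -
  have split: "z powr p = z * z powr (p - 1)" if "z \<ge> 0" for z :: real
    using powr_mult_base [of z "p - 1"] that by simp
  have "x * x powr (p - 1) + y * y powr (p - 1)
      \<le> x * (x + y) powr (p - 1) + y * (x + y) powr (p - 1)"
    using assms by (intro add_mono mult_left_mono powr_mono2) auto
  then show ?thesis
    using assms by (simp add: split algebra_simps)
qed

lemma powr_le_tangent:
  fixes x a :: real
  assumes "x \<ge> 0" "0 \<le> a" "a \<le> 1"
  shows "x powr a \<le> 1 + a * (x - 1)"
proof (cases "x = 0")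
  case False
  then show ?thesis
    using Youngs_inequality_0 [of a "1 - a" x 1] assms by (simp add: algebra_simps)
qed (use assms in simp)

lemma powr_ge_one_plus_ln:
  fixes x a :: real
  assumes "x > 0"
  shows "1 + a * ln x \<le> x powr a"
  using assms exp_ge_add_one_self [of "a * ln x"] by (simp add: powr_def)

lemma ln_ge_chord:
  fixes v :: real
  assumes "1 \<le> v" "v \<le> 2"
  shows "2 / 3 * (v - 1) \<le> ln v"
proof -
  have "(1 - (v - 1)) * ln 1 + (v - 1) * ln 2 \<le> ln ((1 - (v - 1)) * 1 + (v - 1) * (2 :: real))"
    using concave_onD [OF ln_concave, of "v - 1" 1 2] assms by simp
  also have "(1 - (v - 1)) * 1 + (v - 1) * 2 = v"
    by (simp add: algebra_simps)
  finally have "(v - 1) * ln 2 \<le> ln v"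
    by simp
  moreover have "(v - 1) * (2 / 3) \<le> (v - 1) * ln 2"
    using assms ln2_ge_two_thirds by (intro mult_left_mono) auto
  ultimately show ?thesis by (simp add: mult.commute)
qed

text \<open>
  Comparing derivatives, both sides of \<open>1\<close> reduce to superadditivity of the power \<open>\<alpha> - 1 \<ge> 1\<close>:
  applied to \<open>v = (v - 1) + 1\<close> on the right and to \<open>1 = v + (1 - v)\<close> on the left.
\<close>

lemma power_gap_ge_abs_powr:
  assumes "\<alpha> \<ge> 2" "u \<ge> 0"
  shows "\<bar>u - 1\<bar> powr \<alpha> \<le> power_gap \<alpha> u"
proof (cases "u \<ge> 1")
  case True
  have "(u - 1) powr \<alpha> \<le> power_gap \<alpha> u"
  proof (rule power_gap_ge_right [where c = 1 and H = "\<lambda>v. (v - 1) powr \<alpha>"])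
    fix v :: real assume v: "1 < v" "v < u"
    have "(v - 1) powr (\<alpha> - 1) + 1 powr (\<alpha> - 1) \<le> (v - 1 + 1) powr (\<alpha> - 1)"
      using v assms by (intro powr_superadditive) auto
    then have "\<alpha> * (v - 1) powr (\<alpha> - 1) \<le> \<alpha> * (v powr (\<alpha> - 1) - 1)"
      using assms by (intro mult_left_mono) auto
    moreover have "((\<lambda>v. (v - 1) powr \<alpha>) has_real_derivative \<alpha> * (v - 1) powr (\<alpha> - 1)) (at v)"
      using v by (auto intro!: derivative_eq_intros)
    ultimately show "\<exists>D. ((\<lambda>v. (v - 1) powr \<alpha>) has_real_derivative D) (at v) \<and>
        D \<le> \<alpha> * (v powr (\<alpha> - 1) - 1)"
      by blast
  qed (use assms True in \<open>auto simp: power_gap_def intro!: continuous_intros continuous_on_powr'\<close>)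
  then show ?thesis using True by simp
next
  case False
  have "(1 - u) powr \<alpha> \<le> power_gap \<alpha> u"
  proof (rule power_gap_ge_left [where H = "\<lambda>v. (1 - v) powr \<alpha>"])
    fix v :: real assume v: "u < v" "v < 1"
    have "v powr (\<alpha> - 1) + (1 - v) powr (\<alpha> - 1) \<le> (v + (1 - v)) powr (\<alpha> - 1)"
      using v assms by (intro powr_superadditive) auto
    then have "\<alpha> * (v powr (\<alpha> - 1) - 1) \<le> \<alpha> * - ((1 - v) powr (\<alpha> - 1))"
      using assms by (intro mult_left_mono) auto
    moreover have "((\<lambda>v. (1 - v) powr \<alpha>) has_real_derivative
        \<alpha> * - ((1 - v) powr (\<alpha> - 1))) (at v)"
      using v by (auto intro!: derivative_eq_intros)
    ultimately show "\<exists>D. ((\<lambda>v. (1 - v) powr \<alpha>) has_real_derivative D) (at v) \<and>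
        \<alpha> * (v powr (\<alpha> - 1) - 1) \<le> D"
      by blast
  qed (use assms False in \<open>auto intro!: continuous_intros continuous_on_powr'\<close>)
  then show ?thesis using False by (simp add: abs_if)
qed

text \<open>
  On the right the slope of the gap is at least \<open>(\<alpha> - 1) ln v\<close>, and \<open>ln\<close> lies above its chord over
  \<open>[1, 2]\<close>, whose slope is \<open>ln 2 \<ge> 2 / 3\<close>; this is where the constant \<open>1 / 3\<close> comes from. On the
  left the tangent to the concave power \<open>\<alpha> - 1\<close> even gives \<open>\<alpha> / 2\<close> in place of \<open>1 / 3\<close>.
\<close>

lemma power_gap_ge_square:
  assumes \<alpha>: "1 < \<alpha>" "\<alpha> \<le> 2" and u: "0 \<le> u" "u \<le> 2"
  shows "(\<alpha> - 1) / 3 * (u - 1)\<^sup>2 \<le> power_gap \<alpha> u"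
proof -
  let ?H = "\<lambda>v. (\<alpha> - 1) / 3 * (v - 1)\<^sup>2"
  have H: "(?H has_real_derivative (\<alpha> - 1) * (2 / 3 * (v - 1))) (at v)" for v
    by (auto intro!: derivative_eq_intros simp: field_simps)
  show ?thesis
  proof (cases "u \<ge> 1")
    case True
    show ?thesis
    proof (rule power_gap_ge_right [where c = 1 and H = ?H])
      fix v :: real assume v: "1 < v" "v < u"
      have "(\<alpha> - 1) * (2 / 3 * (v - 1)) \<le> (\<alpha> - 1) * ln v"
        using v u \<alpha> by (intro mult_left_mono ln_ge_chord) auto
      also have "\<dots> \<le> v powr (\<alpha> - 1) - 1"
        using powr_ge_one_plus_ln [of v "\<alpha> - 1"] v by simp
      also have "\<dots> \<le> \<alpha> * (v powr (\<alpha> - 1) - 1)"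
        using v \<alpha> ge_one_powr_ge_zero [of v "\<alpha> - 1"]
          mult_right_mono [of 1 \<alpha> "v powr (\<alpha> - 1) - 1"] by simp
      finally show "\<exists>D. (?H has_real_derivative D) (at v) \<and> D \<le> \<alpha> * (v powr (\<alpha> - 1) - 1)"
        using H by blast
    qed (use \<alpha> True in \<open>auto simp: power_gap_def intro!: continuous_intros\<close>)
  next
    case False
    show ?thesis
    proof (rule power_gap_ge_left [where H = ?H])
      fix v :: real assume v: "u < v" "v < 1"
      have "\<alpha> * (v powr (\<alpha> - 1) - 1) \<le> \<alpha> * ((\<alpha> - 1) * (v - 1))"
        using v u \<alpha> powr_le_tangent [of v "\<alpha> - 1"] by (intro mult_left_mono) auto
      also have "\<dots> = (\<alpha> - 1) * (\<alpha> * (v - 1))"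
        by simp
      also have "\<dots> \<le> (\<alpha> - 1) * (2 / 3 * (v - 1))"
        using v \<alpha> by (intro mult_left_mono mult_right_mono_neg) auto
      finally show "\<exists>D. (?H has_real_derivative D) (at v) \<and> \<alpha> * (v powr (\<alpha> - 1) - 1) \<le> D"
        using H by blast
    qed (use \<alpha> u False in \<open>auto intro!: continuous_intros\<close>)
  qed
qed

text \<open>
  The quadratic bound provides the starting value at \<open>u = 2\<close>, where both lower bounds agree. Beyond
  it, the slope of the gap must absorb the constant \<open>1\<close>, which it does because \<open>v\<close> is at least \<open>2\<close>.
\<close>

lemma power_gap_ge_powr:
  assumes \<alpha>: "1 < \<alpha>" "\<alpha> \<le> 2" and u: "2 \<le> u"
  shows "(\<alpha> - 1) / 3 * (u - 1) powr \<alpha> \<le> power_gap \<alpha> u"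
proof (rule power_gap_ge_right [where c = 2 and H = "\<lambda>v. (\<alpha> - 1) / 3 * (v - 1) powr \<alpha>"])
  show "(\<alpha> - 1) / 3 * (2 - 1) powr \<alpha> \<le> power_gap \<alpha> 2"
    using power_gap_ge_square [of \<alpha> 2] \<alpha> by simp
next
  fix v :: real assume v: "2 < v" "v < u"
  let ?y = "v powr (\<alpha> - 1)"
  \<comment> \<open>The power \<open>\<alpha> - 1\<close> of \<open>1 / 2\<close> is at most \<open>1 - (\<alpha> - 1) / 2\<close>, so \<open>1\<close> is at most this
    fraction of \<open>?y\<close>.\<close>
  have "1 = (2 * (1 / 2)) powr (\<alpha> - 1)"
    by simp
  also have "\<dots> = 2 powr (\<alpha> - 1) * (1 / 2) powr (\<alpha> - 1)"
    by (rule powr_mult)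
  also have "\<dots> \<le> ?y * (1 - (\<alpha> - 1) / 2)"
    using v \<alpha> powr_le_tangent [of "1 / 2" "\<alpha> - 1"] by (intro mult_mono powr_mono2) auto
  finally have "(\<alpha> - 1) / 2 * ?y \<le> ?y - 1"
    by (simp add: algebra_simps)
  moreover have "(\<alpha> - 1) / 3 * (v - 1) powr (\<alpha> - 1) \<le> (\<alpha> - 1) / 2 * ?y"
    using v \<alpha> by (intro mult_mono powr_mono2) auto
  ultimately have "(\<alpha> - 1) / 3 * (v - 1) powr (\<alpha> - 1) \<le> ?y - 1"
    by linarith
  then have "\<alpha> * ((\<alpha> - 1) / 3 * (v - 1) powr (\<alpha> - 1)) \<le> \<alpha> * (?y - 1)"
    using \<alpha> by (intro mult_left_mono) auto
  moreover have "((\<lambda>v. (\<alpha> - 1) / 3 * (v - 1) powr \<alpha>) has_real_derivative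
      \<alpha> * ((\<alpha> - 1) / 3 * (v - 1) powr (\<alpha> - 1))) (at v)"
    using v by (auto intro!: derivative_eq_intros)
  ultimately show "\<exists>D. ((\<lambda>v. (\<alpha> - 1) / 3 * (v - 1) powr \<alpha>) has_real_derivative D) (at v) \<and>
      D \<le> \<alpha> * (?y - 1)"
    by blast
qed (use \<alpha> u in \<open>auto intro!: continuous_intros continuous_on_powr'\<close>)

lemma power_gap_nonneg:
  assumes "1 < \<alpha>" "u \<ge> 0"
  shows "power_gap \<alpha> u \<ge> 0"
proof (cases "\<alpha> \<le> 2")
  case True
  have "0 \<le> (\<alpha> - 1) / 3 * (u - 1)\<^sup>2" "0 \<le> (\<alpha> - 1) / 3 * (u - 1) powr \<alpha>"
    using assms by auto
  then show ?thesis
    using power_gap_ge_square [of \<alpha> u] power_gap_ge_powr [of \<alpha> u] assms True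
    by (cases "u \<le> 2") linarith+
next
  case False
  then show ?thesis
    using power_gap_ge_abs_powr [of \<alpha> u] assms powr_ge_zero [of "\<bar>u - 1\<bar>" \<alpha>] by linarith
qed

text \<open>
  A pointwise form of Jensen's inequality. Near \<open>1\<close>, where \<open>g\<close> dominates the square of \<open>u - 1\<close>, the
  concave power \<open>\<alpha> / 2\<close> of that square is replaced by its tangent at an arbitrary point \<open>s\<close>. The
  bound is affine in \<open>g\<close>, so after integration only the mean of \<open>g\<close> enters, and the first summand
  is at most the power \<open>\<alpha> / 2\<close> of \<open>s\<close> as soon as \<open>s\<close> is at least that mean. Both summands are
  nonnegative, so one formula serves both regions.
\<close>

lemma abs_powr_le_power_gap:
  assumes \<alpha>: "1 < \<alpha>" "\<alpha> \<le> 2" and "u \<ge> 0" and s: "s > 0"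
  defines "g \<equiv> 3 / (\<alpha> - 1) * power_gap \<alpha> u"
  shows "\<bar>u - 1\<bar> powr \<alpha> \<le> s powr (\<alpha> / 2) * (1 + \<alpha> / 2 * (g / s - 1)) + g"
proof -
  have g0: "g \<ge> 0"
    using power_gap_nonneg [of \<alpha> u] assms by (simp add: g_def)
  have tangent: "(x / s) powr (\<alpha> / 2) \<le> 1 + \<alpha> / 2 * (x / s - 1)" if "x \<ge> 0" for x
    using that \<alpha> s by (intro powr_le_tangent) auto
  show ?thesis
  proof (cases "u \<le> 2")
    case True
    have sq: "(u - 1)\<^sup>2 \<le> g"
      using power_gap_ge_square [of \<alpha> u] assms True by (simp add: g_def field_simps)
    have "(u - 1)\<^sup>2 = \<bar>u - 1\<bar> powr 2"
      by simp
    then have "\<bar>u - 1\<bar> powr \<alpha> = ((u - 1)\<^sup>2) powr (\<alpha> / 2)"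
      by (simp only: powr_powr) simp
    also have "\<dots> = s powr (\<alpha> / 2) * ((u - 1)\<^sup>2 / s) powr (\<alpha> / 2)"
      using s by (simp add: powr_divide)
    also have "\<dots> \<le> s powr (\<alpha> / 2) * (1 + \<alpha> / 2 * ((u - 1)\<^sup>2 / s - 1))"
      by (intro mult_left_mono tangent) auto
    also have "\<dots> \<le> s powr (\<alpha> / 2) * (1 + \<alpha> / 2 * (g / s - 1))"
      using sq \<alpha> s by (intro mult_left_mono add_left_mono diff_right_mono divide_right_mono) auto
    finally show ?thesis using g0 by linarith
  next
    case False
    have "\<bar>u - 1\<bar> powr \<alpha> \<le> g"
      using power_gap_ge_powr [of \<alpha> u] assms False by (simp add: g_def field_simps)
    moreover have "0 \<le> 1 + \<alpha> / 2 * (g / s - 1)"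
      by (rule order_trans [OF powr_ge_zero tangent [OF g0]])
    then have "0 \<le> s powr (\<alpha> / 2) * (1 + \<alpha> / 2 * (g / s - 1))"
      by (intro mult_nonneg_nonneg powr_ge_zero)
    ultimately show ?thesis by linarith
  qed
qed

section \<open>Hoelder's inequality\<close>

text \<open>
  Young's inequality, applied to the normalised functions \<open>f / A\<close> and \<open>g / B\<close>. If a bound is \<open>0\<close>,
  normalisation is impossible, but then that function vanishes almost everywhere.
\<close>

lemma nn_integral_Hoelder:
  fixes f g :: "'a \<Rightarrow> real"
  assumes [measurable]: "f \<in> borel_measurable M" "g \<in> borel_measurable M"
    and f0: "\<And>x. x \<in> space M \<Longrightarrow> f x \<ge> 0" and g0: "\<And>x. x \<in> space M \<Longrightarrow> g x \<ge> 0"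
    and pq: "p > 1" "q > 1" "1 / p + 1 / q = 1"
    and AB: "A \<ge> 0" "B \<ge> 0"
    and A: "(\<integral>\<^sup>+ x. ennreal (f x powr p) \<partial>M) \<le> ennreal (A powr p)"
    and B: "(\<integral>\<^sup>+ x. ennreal (g x powr q) \<partial>M) \<le> ennreal (B powr q)"
  shows "(\<integral>\<^sup>+ x. ennreal (f x * g x) \<partial>M) \<le> ennreal (A * B)"
proof -
  have zero: "(\<integral>\<^sup>+ x. ennreal (f x * g x) \<partial>M) = 0"
    if [measurable]: "h \<in> borel_measurable M" and "(\<integral>\<^sup>+ x. ennreal (h x powr r) \<partial>M) \<le> ennreal (0 powr r)"
      and "h = f \<or> h = g" for h r
  proof -
    have "(\<integral>\<^sup>+ x. ennreal (h x powr r) \<partial>M) = 0"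
      using that by simp
    then have "AE x in M. ennreal (h x powr r) = 0"
      by (subst (asm) nn_integral_0_iff_AE) auto
    then have "AE x in M. ennreal (f x * g x) = 0"
      using that(3) by (auto elim!: eventually_mono)
    then show ?thesis
      by (subst nn_integral_0_iff_AE) auto
  qed
  consider "A = 0" | "B = 0" | "A > 0" "B > 0"
    using AB by linarith
  then show ?thesis
  proof cases
    case 3
    have "f x * g x \<le> A * B / p * A powr - p * f x powr p + A * B / q * B powr - q * g x powr q"
      if "x \<in> space M" for x
    proof -
      have "f x / A * (g x / B) \<le> (f x / A) powr p / p + (g x / B) powr q / q"
        using f0 g0 that 3 pq by (intro Youngs_inequality) auto
      then have "A * B * (f x / A * (g x / B)) \<le> A * B * ((f x / A) powr p / p + (g x / B) powr q / q)"
        using 3 by (intro mult_left_mono) auto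
      then show ?thesis
        using 3 by (simp add: powr_divide powr_minus_divide algebra_simps)
    qed
    then have "(\<integral>\<^sup>+ x. ennreal (f x * g x) \<partial>M) \<le>
        (\<integral>\<^sup>+ x. ennreal (A * B / p * A powr - p) * ennreal (f x powr p) +
              ennreal (A * B / q * B powr - q) * ennreal (g x powr q) \<partial>M)"
      using 3 pq by (intro nn_integral_mono)
        (simp add: ennreal_mult [symmetric] ennreal_plus [symmetric] ennreal_leI del: ennreal_plus)
    also have "\<dots> = ennreal (A * B / p * A powr - p) * (\<integral>\<^sup>+ x. ennreal (f x powr p) \<partial>M) +
        ennreal (A * B / q * B powr - q) * (\<integral>\<^sup>+ x. ennreal (g x powr q) \<partial>M)"
      by (simp add: nn_integral_add nn_integral_cmult)
    also have "\<dots> \<le> ennreal (A * B / p * A powr - p) * ennreal (A powr p) +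
        ennreal (A * B / q * B powr - q) * ennreal (B powr q)"
      by (intro add_mono mult_left_mono A B) auto
    also have "\<dots> = ennreal (A * B / p + A * B / q)"
      using 3 pq by (simp add: ennreal_mult [symmetric] ennreal_plus [symmetric] powr_minus_divide
          del: ennreal_plus)
    also have "A * B / p + A * B / q = A * B * (1 / p + 1 / q)"
      by (simp add: algebra_simps)
    finally show ?thesis using pq by simp
  qed (use zero [of f p] zero [of g q] A B in auto)
qed

section \<open>Total variation of a measure with a density\<close>

text \<open>
  On each measurable set \<open>B\<close> the difference of the two measures is the integral of \<open>f - 1\<close>, so the
  sum over a partition of \<open>A\<close> never exceeds \<open>\<integral>\<^sub>A |f - 1| d\<mu>\<close>. An inequality is enough for an upper
  bound on the total variation, and it avoids proving that the supremum over partitions is countably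
  additive: \<^const>\<open>measure_of\<close> assigns to a measurable set either that supremum or \<open>0\<close>.
\<close>

lemma tv_measure_density_le:
  fixes f :: "'a \<Rightarrow> real"
  assumes "finite_measure \<mu>" and f: "integrable \<mu> f" "\<And>x. f x \<ge> 0"
  shows "tv_measure (density \<mu> f) \<mu> \<le> density \<mu> (\<lambda>x. \<bar>f x - 1\<bar>)"
proof -
  interpret finite_measure \<mu> by fact
  let ?\<nu> = "density \<mu> f" and ?D = "density \<mu> (\<lambda>x. \<bar>f x - 1\<bar>)"
  have [measurable]: "f \<in> borel_measurable \<mu>"
    using f by auto
  have diff: "ennreal \<bar>measure ?\<nu> B - measure \<mu> B\<bar> \<le> emeasure ?D B" if [measurable]: "B \<in> sets \<mu>" for B
  proof -
    have int_f: "integrable \<mu> (\<lambda>x. f x * indicator B x)"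
      and int: "integrable \<mu> (\<lambda>x. (f x - 1) * indicator B x)"
      using f by (intro integrable_real_mult_indicator; simp)+
    have "emeasure ?\<nu> B = (\<integral>\<^sup>+ x. ennreal (f x * indicator B x) \<partial>\<mu>)"
      by (subst emeasure_density) (auto intro!: nn_integral_cong split: split_indicator)
    also have "\<dots> = ennreal (\<integral>x. f x * indicator B x \<partial>\<mu>)"
      using f int_f by (intro nn_integral_eq_integral) auto
    finally have "measure ?\<nu> B = (\<integral>x. f x * indicator B x \<partial>\<mu>)"
      using f by (simp add: measure_def)
    moreover have "measure \<mu> B = (\<integral>x. indicator B x \<partial>\<mu>)"
      by simp
    ultimately have "measure ?\<nu> B - measure \<mu> B = (\<integral>x. f x * indicator B x - indicator B x \<partial>\<mu>)"
      using int_f by (subst Bochner_Integration.integral_diff)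
        (auto simp: integrable_real_indicator less_top [symmetric])
    then have "\<bar>measure ?\<nu> B - measure \<mu> B\<bar> \<le> (\<integral>x. \<bar>(f x - 1) * indicator B x\<bar> \<partial>\<mu>)"
      by (simp only: left_diff_distrib mult_1_left integral_abs_bound)
    then have "ennreal \<bar>measure ?\<nu> B - measure \<mu> B\<bar> \<le>
        ennreal (\<integral>x. \<bar>(f x - 1) * indicator B x\<bar> \<partial>\<mu>)"
      by (rule ennreal_leI)
    also have "\<dots> = (\<integral>\<^sup>+ x. ennreal \<bar>(f x - 1) * indicator B x\<bar> \<partial>\<mu>)"
      using int by (intro nn_integral_eq_integral [symmetric] integrable_abs) auto
    also have "\<dots> = emeasure ?D B"
      by (subst emeasure_density) (auto intro!: nn_integral_cong split: split_indicator)
    finally show ?thesis .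
  qed
  have part: "(\<Sum>B\<in>P. ennreal \<bar>measure ?\<nu> B - measure \<mu> B\<bar>) \<le> emeasure ?D A"
    if P: "finite P" "P \<subseteq> sets \<mu>" "partition_on A P" for A P
  proof -
    have "(\<Sum>B\<in>P. ennreal \<bar>measure ?\<nu> B - measure \<mu> B\<bar>) \<le> (\<Sum>B\<in>P. emeasure ?D B)"
      using P diff by (intro sum_mono) auto
    also have "\<dots> = emeasure ?D (\<Union>B\<in>P. B)"
      using P by (intro sum_emeasure) (auto simp: partition_on_def disjoint_family_on_def disjoint_def)
    finally show ?thesis
      using P by (simp add: partition_on_def)
  qed
  show ?thesis
  proof (subst le_measure)
    show "sets (tv_measure ?\<nu> \<mu>) = sets ?D"
      by (simp add: tv_measure_def)
    show "\<forall>A\<in>sets (tv_measure ?\<nu> \<mu>). emeasure (tv_measure ?\<nu> \<mu>) A \<le> emeasure ?D A"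
      using part by (auto simp: tv_measure_def emeasure_measure_of_conv intro!: SUP_least)
  qed
qed

lemma weighted_tv_density_le:
  fixes f :: "'a \<Rightarrow> real"
  assumes "finite_measure \<mu>" and f: "integrable \<mu> f" "\<And>x. f x \<ge> 0"
    and [measurable]: "w \<in> borel_measurable \<mu>"
  shows "weighted_tv w (density \<mu> f) \<mu> \<le> enn2ereal (\<integral>\<^sup>+ x. ennreal (w x * \<bar>f x - 1\<bar>) \<partial>\<mu>)"
proof -
  have [measurable]: "f \<in> borel_measurable \<mu>"
    using f by auto
  have "(\<integral>\<^sup>+ x. ennreal (w x) \<partial>tv_measure (density \<mu> f) \<mu>)
      \<le> (\<integral>\<^sup>+ x. ennreal (w x) \<partial>density \<mu> (\<lambda>x. \<bar>f x - 1\<bar>))"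
    using tv_measure_density_le [OF assms(1-3)]
    by (intro nn_integral_mono_measure) (auto simp: tv_measure_def)
  also have "\<dots> = (\<integral>\<^sup>+ x. ennreal \<bar>f x - 1\<bar> * ennreal (w x) \<partial>\<mu>)"
    by (subst nn_integral_density) auto
  also have "\<dots> = (\<integral>\<^sup>+ x. ennreal (w x * \<bar>f x - 1\<bar>) \<partial>\<mu>)"
    by (simp add: ennreal_mult'' mult.commute)
  finally show ?thesis
    by (simp add: weighted_tv_def less_eq_ennreal.rep_eq)
qed

section \<open>The density of a measure at finite Renyi divergence\<close>

text \<open>
  A finite divergence forces absolute continuity, and \<open>\<nu>\<close> being finite makes the Radon-Nikodym
  derivative finite almost everywhere. Hence a real-valued density exists, and all quantities can be
  expressed by Bochner integrals.
\<close>

lemma tsallis_finite_density: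
  fixes \<mu> \<nu> :: "'a measure"
  assumes "prob_space \<mu>" "prob_space \<nu>" and sets: "sets \<nu> = sets \<mu>" and "\<alpha> > 1"
    and fin: "tsallis \<alpha> \<nu> \<mu> \<noteq> \<infinity>"
  obtains f :: "'a \<Rightarrow> real"
  where "\<And>x. f x \<ge> 0" "integrable \<mu> f" "integral\<^sup>L \<mu> f = 1" "integrable \<mu> (\<lambda>x. f x powr \<alpha>)"
    "\<nu> = density \<mu> f" "tsallis \<alpha> \<nu> \<mu> = ereal (((\<integral>x. f x powr \<alpha> \<partial>\<mu>) - 1) / (\<alpha> - 1))"
proof
  interpret \<mu>: prob_space \<mu> by fact
  interpret \<nu>: prob_space \<nu> by fact
  define f where "f = (\<lambda>x. enn2real (RN_deriv \<mu> \<nu> x))"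
  have [measurable]: "f \<in> borel_measurable \<mu>"
    by (simp add: f_def)
  have ac: "absolutely_continuous \<mu> \<nu>"
    using fin by (simp add: tsallis_def split: if_splits)
  show f0: "f x \<ge> 0" for x
    by (simp add: f_def)
  have ae: "AE x in \<mu>. RN_deriv \<mu> \<nu> x = ennreal (f x)"
    using \<mu>.RN_deriv_finite [OF \<nu>.sigma_finite_measure ac sets]
    by (auto elim!: eventually_mono simp: f_def less_top)
  have "density \<mu> (RN_deriv \<mu> \<nu>) = density \<mu> f"
    using ae by (intro density_cong) auto
  then show \<nu>: "\<nu> = density \<mu> f"
    using \<mu>.density_RN_deriv [OF ac sets] by simp
  have "(\<integral>\<^sup>+ x. ennreal (f x) \<partial>\<mu>) = emeasure \<nu> (space \<mu>)"
    by (subst \<nu>, subst emeasure_density) (auto intro!: nn_integral_cong)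
  also have "\<dots> = 1"
    using \<nu>.emeasure_space_1 sets_eq_imp_space_eq [OF sets] by simp
  finally have one: "(\<integral>\<^sup>+ x. ennreal (f x) \<partial>\<mu>) = 1" .
  then show "integrable \<mu> f"
    using f0 by (intro integrableI_nonneg) auto
  show "integral\<^sup>L \<mu> f = 1"
    using one f0 by (subst integral_eq_nn_integral) auto
  define I where "I = (\<integral>\<^sup>+ x. ennreal (f x powr \<alpha>) \<partial>\<mu>)"
  have T: "tsallis \<alpha> \<nu> \<mu> = ereal (1 / (\<alpha> - 1)) * (enn2ereal I - 1)"
    using ac by (simp add: tsallis_def I_def f_def)
  have "I \<noteq> \<infinity>"
    using fin \<open>\<alpha> > 1\<close> unfolding T by auto
  then show int: "integrable \<mu> (\<lambda>x. f x powr \<alpha>)"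
    unfolding I_def by (intro integrableI_nonneg) (auto simp: less_top)
  have "I = ennreal (\<integral>x. f x powr \<alpha> \<partial>\<mu>)"
    unfolding I_def using int by (intro nn_integral_eq_integral) auto
  then show "tsallis \<alpha> \<nu> \<mu> = ereal (((\<integral>x. f x powr \<alpha> \<partial>\<mu>) - 1) / (\<alpha> - 1))"
    unfolding T by (simp add: enn2ereal_ennreal one_ereal_def)
qed

context prob_space
begin

text \<open>The linear term of the gap integrates to \<open>0\<close>, because the density has mean \<open>1\<close>.\<close>

lemma integral_power_gap:
  assumes "integrable M f" "integral\<^sup>L M f = 1" "integrable M (\<lambda>x. f x powr \<alpha>)"
  shows "integrable M (\<lambda>x. power_gap \<alpha> (f x))"
    and "(\<integral>x. power_gap \<alpha> (f x) \<partial>M) = (\<integral>x. f x powr \<alpha> \<partial>M) - 1"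
  using assms by (simp_all add: power_gap_def prob_space)

text \<open>
  The pointwise bounds, integrated. In the case \<open>\<alpha> \<le> 2\<close> the tangent point is \<open>s = 3 T\<close>, the mean of
  the function that dominates \<open>(f - 1)\<^sup>2\<close> near \<open>1\<close>; as \<open>s\<close> must be positive, \<open>T = 0\<close> is reached by
  letting \<open>s\<close> tend to \<open>0\<close>.
\<close>

lemma central_moment_le:
  fixes f :: "'a \<Rightarrow> real"
  assumes f: "\<And>x. f x \<ge> 0" "integrable M f" "integral\<^sup>L M f = 1" "integrable M (\<lambda>x. f x powr \<alpha>)"
    and \<alpha>: "\<alpha> > 1"
  defines "T \<equiv> ((\<integral>x. f x powr \<alpha> \<partial>M) - 1) / (\<alpha> - 1)"
  shows "T \<ge> 0"
    and "\<alpha> \<ge> 2 \<Longrightarrow> (\<integral>\<^sup>+ x. ennreal (\<bar>f x - 1\<bar> powr \<alpha>) \<partial>M) \<le> ennreal ((\<alpha> - 1) * T)"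
    and "\<alpha> \<le> 2 \<Longrightarrow> (\<integral>\<^sup>+ x. ennreal (\<bar>f x - 1\<bar> powr \<alpha>) \<partial>M) \<le> ennreal ((3 * T) powr (\<alpha> / 2) + 3 * T)"
proof -
  note gap_int = integral_power_gap(1) [OF f(2-4)]
  have gap_eq: "(\<integral>x. power_gap \<alpha> (f x) \<partial>M) = (\<alpha> - 1) * T"
    using integral_power_gap(2) [OF f(2-4)] \<alpha> by (simp add: T_def)
  have "0 \<le> (\<alpha> - 1) * T"
    unfolding gap_eq [symmetric] using f \<alpha> by (intro integral_nonneg_AE) (simp add: power_gap_nonneg)
  then show T0: "T \<ge> 0"
    using \<alpha> by (simp add: zero_le_mult_iff)
  have dominated: "(\<integral>\<^sup>+ x. ennreal (\<bar>f x - 1\<bar> powr \<alpha>) \<partial>M) \<le> ennreal (\<integral>x. h x \<partial>M)"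
    if "integrable M h" "\<And>x. \<bar>f x - 1\<bar> powr \<alpha> \<le> h x" for h
  proof -
    have "0 \<le> h x" for x
      using that(2) [of x] powr_ge_zero [of "\<bar>f x - 1\<bar>" \<alpha>] by linarith
    then show ?thesis
      using that by (subst nn_integral_eq_integral [symmetric]) (auto intro!: nn_integral_mono ennreal_leI)
  qed
  show "(\<integral>\<^sup>+ x. ennreal (\<bar>f x - 1\<bar> powr \<alpha>) \<partial>M) \<le> ennreal ((\<alpha> - 1) * T)" if "\<alpha> \<ge> 2"
    unfolding gap_eq [symmetric] using that f gap_int by (intro dominated power_gap_ge_abs_powr)
  show "(\<integral>\<^sup>+ x. ennreal (\<bar>f x - 1\<bar> powr \<alpha>) \<partial>M) \<le> ennreal ((3 * T) powr (\<alpha> / 2) + 3 * T)"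
    if \<alpha>2: "\<alpha> \<le> 2"
  proof -
    have bound: "(\<integral>\<^sup>+ x. ennreal (\<bar>f x - 1\<bar> powr \<alpha>) \<partial>M) \<le> ennreal (s powr (\<alpha> / 2) + 3 * T)"
      if s: "s > 0" "3 * T \<le> s" for s
    proof -
      define g where "g = (\<lambda>x. 3 / (\<alpha> - 1) * power_gap \<alpha> (f x))"
      have g: "integrable M g" "integral\<^sup>L M g = 3 * T"
        using gap_int gap_eq \<alpha> by (simp_all add: g_def)
      have "(\<integral>\<^sup>+ x. ennreal (\<bar>f x - 1\<bar> powr \<alpha>) \<partial>M) \<le>
          ennreal (\<integral>x. s powr (\<alpha> / 2) * (1 + \<alpha> / 2 * (g x / s - 1)) + g x \<partial>M)"
      proof (rule dominated)
        show "integrable M (\<lambda>x. s powr (\<alpha> / 2) * (1 + \<alpha> / 2 * (g x / s - 1)) + g x)"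
          using g(1) by simp
        show "\<bar>f x - 1\<bar> powr \<alpha> \<le> s powr (\<alpha> / 2) * (1 + \<alpha> / 2 * (g x / s - 1)) + g x" for x
          unfolding g_def using f(1) \<alpha> \<alpha>2 s(1) by (intro abs_powr_le_power_gap)
      qed
      also have "(\<integral>x. s powr (\<alpha> / 2) * (1 + \<alpha> / 2 * (g x / s - 1)) + g x \<partial>M) =
          s powr (\<alpha> / 2) * (1 + \<alpha> / 2 * (3 * T / s - 1)) + 3 * T"
        using g by (simp add: prob_space)
      also have "\<dots> \<le> s powr (\<alpha> / 2) * 1 + 3 * T"
        using s \<alpha> by (intro add_right_mono mult_left_mono) (auto simp: mult_le_0_iff)
      finally show ?thesis by (auto intro: ennreal_leI order_trans)
    qed
    show ?thesis
    proof (cases "T = 0")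
      case False
      then show ?thesis using bound [of "3 * T"] T0 by simp
    next
      case True
      have "(\<integral>\<^sup>+ x. ennreal (\<bar>f x - 1\<bar> powr \<alpha>) \<partial>M) \<le> 0 + ennreal e" if "e > 0" for e
        using bound [of "e powr (2 / \<alpha>)"] True that \<alpha> by (simp add: powr_powr)
      then have "(\<integral>\<^sup>+ x. ennreal (\<bar>f x - 1\<bar> powr \<alpha>) \<partial>M) \<le> 0"
        by (rule ennreal_le_epsilon)
      then show ?thesis by simp
    qed
  qed
qed

end

section \<open>The weighted inequality\<close>

text \<open>
  Both \<open>T\<close> and its power \<open>\<alpha> / 2\<close> are at most \<open>M\<^sup>\<alpha>\<close>. For the constants, \<open>\<surd>3 \<le> 2\<close> and
  superadditivity give \<open>(\<surd>3)\<^sup>\<alpha> + 3 \<le> 2\<^sup>\<alpha> + 3\<^sup>\<alpha> \<le> 5\<^sup>\<alpha>\<close>.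
\<close>

lemma small_order_constant:
  fixes \<alpha> M T :: real
  assumes "1 < \<alpha>" "\<alpha> \<le> 2" "T \<ge> 0" "sqrt T \<le> M" "T powr (1 / \<alpha>) \<le> M"
  shows "(3 * T) powr (\<alpha> / 2) + 3 * T \<le> (16 / 3 * M) powr \<alpha>"
proof -
  have "T = (T powr (1 / \<alpha>)) powr \<alpha>"
    using assms by (simp add: powr_powr)
  also have "\<dots> \<le> M powr \<alpha>"
    using assms by (intro powr_mono2) auto
  finally have T1: "T \<le> M powr \<alpha>" .
  have "T powr (\<alpha> / 2) = sqrt T powr \<alpha>"
    using assms by (simp add: powr_half_sqrt [symmetric] powr_powr)
  also have "\<dots> \<le> M powr \<alpha>"
    using assms by (intro powr_mono2) auto
  finally have T2: "T powr (\<alpha> / 2) \<le> M powr \<alpha>" .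
  have "3 powr (\<alpha> / 2) \<le> (4 :: real) powr (\<alpha> / 2)"
    using assms by (intro powr_mono2) auto
  also have "\<dots> = (4 powr (1 / 2)) powr \<alpha>"
    by (subst powr_powr) simp
  also have "4 powr (1 / 2) = (2 :: real)"
    by (simp add: powr_half_sqrt)
  finally have "3 powr (\<alpha> / 2) \<le> (2 :: real) powr \<alpha>" .
  moreover have "3 powr 1 \<le> (3 :: real) powr \<alpha>"
    using assms by (intro powr_mono) auto
  moreover have "2 powr \<alpha> + 3 powr \<alpha> \<le> (2 + 3 :: real) powr \<alpha>"
    using assms by (intro powr_superadditive) auto
  moreover have "(2 + 3) powr \<alpha> \<le> (16 / 3 :: real) powr \<alpha>"
    using assms by (intro powr_mono2) auto
  ultimately have C: "3 powr (\<alpha> / 2) + 3 \<le> (16 / 3 :: real) powr \<alpha>"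
    by simp
  have "(3 * T) powr (\<alpha> / 2) + 3 * T \<le> 3 powr (\<alpha> / 2) * M powr \<alpha> + 3 * M powr \<alpha>"
    unfolding powr_mult using T1 T2 by (intro add_mono mult_left_mono) auto
  also have "\<dots> = (3 powr (\<alpha> / 2) + 3) * M powr \<alpha>"
    by (simp add: algebra_simps)
  also have "\<dots> \<le> (16 / 3) powr \<alpha> * M powr \<alpha>"
    using C by (intro mult_right_mono) auto
  finally show ?thesis by (simp only: powr_mult)
qed

lemma large_order_constant:
  fixes \<alpha> T :: real
  assumes "2 \<le> \<alpha>" "T \<ge> 0"
  shows "(\<alpha> - 1) * T \<le> (3 powr \<alpha> * T powr (1 / \<alpha>)) powr \<alpha>"
proof -
  have "\<alpha> \<le> exp \<alpha>"
    using exp_ge_add_one_self [of \<alpha>] by linarith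
  also have "\<dots> = exp 1 powr \<alpha>"
    by (simp add: exp_powr_real)
  also have "\<dots> \<le> 3 powr \<alpha>"
    using exp_le assms by (intro powr_mono2) auto
  also have "\<dots> \<le> 3 powr (\<alpha> * \<alpha>)"
    using assms by (intro powr_mono) auto
  finally have "(\<alpha> - 1) * T \<le> 3 powr (\<alpha> * \<alpha>) * T"
    using assms by (intro mult_right_mono) auto
  also have "\<dots> = (3 powr \<alpha> * T powr (1 / \<alpha>)) powr \<alpha>"
    using assms by (simp add: powr_mult powr_powr)
  finally show ?thesis .
qed

lemma weighted_tv_le_lp_norm:
  fixes f w :: "'a \<Rightarrow> real"
  assumes "finite_measure \<mu>" and f: "integrable \<mu> f" "\<And>x. f x \<ge> 0"
    and w: "w \<in> borel_measurable \<mu>" "\<And>x. x \<in> space \<mu> \<Longrightarrow> w x \<ge> 0"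
    and \<alpha>: "\<alpha> > 1" "\<beta> = \<alpha> / (\<alpha> - 1)"
    and B: "B \<ge> 0" "(\<integral>\<^sup>+ x. ennreal (\<bar>f x - 1\<bar> powr \<alpha>) \<partial>\<mu>) \<le> ennreal (B powr \<alpha>)"
    and fin: "lp_norm \<mu> \<beta> w \<noteq> \<infinity>"
  shows "weighted_tv w (density \<mu> f) \<mu> \<le> lp_norm \<mu> \<beta> w * ereal B"
proof -
  have [measurable]: "f \<in> borel_measurable \<mu>" "w \<in> borel_measurable \<mu>"
    using f w by auto
  define W where "W = (\<integral>\<^sup>+ x. ennreal (\<bar>w x\<bar> powr \<beta>) \<partial>\<mu>)"
  have "W \<noteq> \<infinity>"
    using fin by (auto simp: lp_norm_def ext_powr_def W_def)
  then obtain r where r: "r \<ge> 0" "W = ennreal r"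
    by (cases W) auto
  have \<beta>: "\<beta> > 1" "1 / \<beta> + 1 / \<alpha> = 1"
    using \<alpha>(1) unfolding \<alpha>(2) by (simp_all add: field_simps)
  define A where "A = r powr (1 / \<beta>)"
  have lp: "lp_norm \<mu> \<beta> w = ereal A"
    unfolding lp_norm_def W_def [symmetric] using r by (simp add: ext_powr_def A_def enn2ereal_ennreal)
  have "(\<integral>\<^sup>+ x. ennreal (w x powr \<beta>) \<partial>\<mu>) = W"
    unfolding W_def using w by (intro nn_integral_cong) simp
  also have "\<dots> = ennreal (A powr \<beta>)"
    using r \<beta> by (simp add: A_def powr_powr)
  finally have "(\<integral>\<^sup>+ x. ennreal (w x * \<bar>f x - 1\<bar>) \<partial>\<mu>) \<le> ennreal (A * B)"
    using w \<alpha> \<beta> B by (intro nn_integral_Hoelder [where p = \<beta> and q = \<alpha>]) (auto simp: A_def)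
  then have "enn2ereal (\<integral>\<^sup>+ x. ennreal (w x * \<bar>f x - 1\<bar>) \<partial>\<mu>) \<le> enn2ereal (ennreal (A * B))"
    by (simp add: less_eq_ennreal.rep_eq)
  also have "\<dots> = lp_norm \<mu> \<beta> w * ereal B"
    using B by (simp add: lp A_def enn2ereal_ennreal)
  finally show ?thesis
    using weighted_tv_density_le [OF assms(1) f w(1)] by (rule order_trans [rotated])
qed

text \<open>
  An infinite divergence or norm makes both right-hand sides infinite. Otherwise both bounds have the
  form \<open>c * M\<close> times the norm, and each follows from \<open>\<integral> |f - 1|\<^sup>\<alpha> d\<mu> \<le> (c M)\<^sup>\<alpha>\<close>.
\<close>

theorem theorem2p1:
  fixes \<mu> \<nu> :: "'a measure" and w :: "'a \<Rightarrow> real" and \<alpha> \<beta> :: real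
  assumes "prob_space \<mu>"
    and "prob_space \<nu>" and "sets \<nu> = sets \<mu>"
    and "w \<in> borel_measurable \<mu>" and "\<And>x. x \<in> space \<mu> \<Longrightarrow> w x \<ge> 0"
    and "\<alpha> > 1" and "\<beta> = \<alpha> / (\<alpha> - 1)"
  shows "(\<alpha> \<le> 2 \<longrightarrow>
            weighted_tv w \<nu> \<mu> \<le>
              ereal (16 / 3) * ext_mult (lp_norm \<mu> \<beta> w)
                (max (ext_sqrt (tsallis \<alpha> \<nu> \<mu>)) (ext_powr (tsallis \<alpha> \<nu> \<mu>) (1 / \<alpha>)))) \<and>
         (\<alpha> \<ge> 2 \<longrightarrow>
            weighted_tv w \<nu> \<mu> \<le>
              ereal (3 powr \<alpha>) * ext_mult (lp_norm \<mu> \<beta> w)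
                (ext_powr (tsallis \<alpha> \<nu> \<mu>) (1 / \<alpha>)))"
proof (cases "tsallis \<alpha> \<nu> \<mu> = \<infinity> \<or> lp_norm \<mu> \<beta> w = \<infinity>")
  case True
  then show ?thesis
    by (auto simp: ext_mult_def ext_sqrt_def ext_powr_def)
next
  case False
  interpret \<mu>: prob_space \<mu> by fact
  obtain f :: "'a \<Rightarrow> real" where
    f: "\<And>x. f x \<ge> 0" "integrable \<mu> f" "integral\<^sup>L \<mu> f = 1" "integrable \<mu> (\<lambda>x. f x powr \<alpha>)"
    and \<nu>: "\<nu> = density \<mu> f"
    and tsallis: "tsallis \<alpha> \<nu> \<mu> = ereal (((\<integral>x. f x powr \<alpha> \<partial>\<mu>) - 1) / (\<alpha> - 1))"
    using tsallis_finite_density [OF assms(1-3,6)] False by blast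
  define T where "T = ((\<integral>x. f x powr \<alpha> \<partial>\<mu>) - 1) / (\<alpha> - 1)"
  note moment = \<mu>.central_moment_le [OF f \<open>\<alpha> > 1\<close>, folded T_def]
  have main: "weighted_tv w \<nu> \<mu> \<le> ereal c * ext_mult (lp_norm \<mu> \<beta> w) (ereal M)"
    if "c \<ge> 0" "M \<ge> 0"
      "(\<integral>\<^sup>+ x. ennreal (\<bar>f x - 1\<bar> powr \<alpha>) \<partial>\<mu>) \<le> ennreal ((c * M) powr \<alpha>)" for c M
  proof -
    have "weighted_tv w \<nu> \<mu> \<le> lp_norm \<mu> \<beta> w * ereal (c * M)"
      unfolding \<nu> using f assms that False
      by (intro weighted_tv_le_lp_norm [OF \<mu>.finite_measure_axioms]) auto
    also have "\<dots> = ereal c * ext_mult (lp_norm \<mu> \<beta> w) (ereal M)"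
      using False by (simp add: ext_mult_def mult_ac flip: times_ereal.simps(1))
    finally show ?thesis .
  qed
  have eq: "ext_powr (tsallis \<alpha> \<nu> \<mu>) (1 / \<alpha>) = ereal (T powr (1 / \<alpha>))"
    "ext_sqrt (tsallis \<alpha> \<nu> \<mu>) = ereal (sqrt T)"
    by (simp_all add: tsallis T_def ext_powr_def ext_sqrt_def)
  show ?thesis
  proof (intro conjI impI)
    assume "\<alpha> \<le> 2"
    then show "weighted_tv w \<nu> \<mu> \<le> ereal (16 / 3) * ext_mult (lp_norm \<mu> \<beta> w)
        (max (ext_sqrt (tsallis \<alpha> \<nu> \<mu>)) (ext_powr (tsallis \<alpha> \<nu> \<mu>) (1 / \<alpha>)))"
      unfolding eq ereal_max [symmetric] using moment assms
      by (intro main order_trans [OF moment(3)] ennreal_leI small_order_constant)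
        (auto simp: le_max_iff_disj)
  next
    assume "\<alpha> \<ge> 2"
    then show "weighted_tv w \<nu> \<mu> \<le> ereal (3 powr \<alpha>) * ext_mult (lp_norm \<mu> \<beta> w)
        (ext_powr (tsallis \<alpha> \<nu> \<mu>) (1 / \<alpha>))"
      unfolding eq using moment
      by (intro main order_trans [OF moment(2)] ennreal_leI large_order_constant) auto
  qed
qed

end
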